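(* Let $\alpha>0$. For a virtual cluster $k$, given a user association $(x_{u,s})$, a CoMP SINR threshold $\Gamma_d$, at least one CoMP user (a user with $\gamma_{u,s}\le\Gamma_d$), and any CoMP time fraction $\theta_k\in[0,1]$, consider the $\alpha$-Fair scheduling problem of maximizing $$\sum_{u\in\mathcal{U}_k}\mathbb{U}_\alpha(\lambda_u)$$ over the $\beta_{u,s}$ and $\beta_{u,k}$, where $$\lambda_u=(1-\theta_k)\sum_{s\in\mathcal{S}_k}x_{u,s}(1-z_{u,s})\beta_{u,s}r_{u,s}+\theta_k\sum_{s\in\mathcal{S}_k}x_{u,s}z_{u,s}\beta_{u,k}r_{u,k},\qquad u\in\mathcal{U}_k,$$ subject to $$\sum_{u\in\mathcal{U}_{nc,s}}\beta_{u,s}\le 1\ \ \forall s\in\mathcal{S}_k,\qquad \sum_{u\in\mathcal{U}_c}\beta_{u,k}\le 1,\qquad \beta_{u,s}\ge 0,\quad \beta_{u,k}\ge 0 .$$ Then the optimal time fraction of $(1-\theta_k)$ allocated by the $\alpha$-Fair scheduler in any sector $s\in\mathcal{S}_k$ to a non-CoMP user $u$ is equal to $$\beta_{u,s}^*=\frac{\mathtt{t}_{u,s,\alpha}}{\sum_{v\in\mathcal{U}_{nc,s}}\mathtt{t}_{v,s,\alpha}},\qquad \forall s\in\mathcal{S}_k,\ \forall u\in\mathcal{U}_{nc,s},\qquad\text{where } \mathtt{t}_{u,s,\alpha}=r_{u,s}^{\frac{1-\alpha}{\alpha}},$$ and the optimal time fraction of $\theta_k$ allocated by the $\alpha$-Fair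 scheduler for all the sectors jointly to a CoMP user $u$ is equal to $$\beta_{u,k}^*=\frac{\mathtt{t}_{u,k,\alpha}}{\sum_{v\in\mathcal{U}_c}\mathtt{t}_{v,k,\alpha}},\qquad \forall u\in\mathcal{U}_c,\qquad\text{where } \mathtt{t}_{u,k,\alpha}=r_{u,k}^{\frac{1-\alpha}{\alpha}} .$$
   Context: Utility function of the $\alpha$-Fair scheduler: $\mathbb{U}_\alpha(\lambda)=\lambda^{1-\alpha}/(1-\alpha)$ if $\alpha>0$, $\alpha\neq1$, and $\mathbb{U}_1(\lambda)=\log\lambda$. Setting: a virtual cluster $k$ is a group $\mathcal{S}_k$ of sectors of a cellular network that can transmit jointly (coordinated multi-point, CoMP) to users; $\mathcal{U}_k$ is the finite set of its users. The user association $x_{u,s}\in\{0,1\}$ is given (it need not be based on maximum SINR); user $u$ is associated with the one sector $s$ for which $x_{u,s}=1$. $\gamma_{u,s}$ is the signal-to-interference-plus-noise ratio (SINR) of user $u$ when served by sector $s$ alone, and $\gamma_{u,k}$ is its SINR when all sectors of $\mathcal{S}_k$ transmit to it jointly. The binary variable $z_{u,s}$ equals $1$ if $|\mathcal{S}_k|>1$ and $\gamma_{u,s}\le\Gamma_d x_{u,s}$, and equals $0$ otherwise. A user $u$ associated with sector $s$ is a CoMP user if $z_{u,s}=1$ and a non-CoMP user if $z_{u,s}=0$. $\mathcal{U}_c$ is the set of CoMP users, $\mathcal{U}_{nc}$ the set of non-CoMP users (so $\mathcal{U}_k=\mathcal{U}_c\cup\mathcal{U}_{nc}$), and $\mathcal{U}_{nc,s}$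 the set of non-CoMP users of sector $s\in\mathcal{S}_k$. Link rates: $r_{u,s}=c\,\eta(\gamma_{u,s})$ and $r_{u,k}=c\,\eta(\gamma_{u,k})$, where $c>0$ is a system constant and $\eta$ is the spectral efficiency as a function of SINR, read from a modulation-and-coding table. Time allocation: $\theta_k$ is the fraction of time in which the sectors of $\mathcal{S}_k$ transmit jointly to the CoMP users, and $\beta_{u,k}$ is the fraction of $\theta_k$ given to CoMP user $u$. In the remaining fraction $1-\theta_k$ each sector individually serves its own non-CoMP users, $\beta_{u,s}$ being the fraction of $1-\theta_k$ given by sector $s$ to its non-CoMP user $u$. $\lambda_u$ is the resulting downlink rate of user $u$. *)

theory Defs
  imports Complex_Main "HOL-Library.Extended_Real"
begin

text \<open>The field \<open>assoc\<close> is the 0/1 matrix \<open>x\<close>, \<open>sinr u s\<close> is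
  \<open>\<gamma>\<^sub>u\<^sub>,\<^sub>s\<close> and \<open>joint_sinr u\<close> is \<open>\<gamma>\<^sub>u\<^sub>,\<^sub>k\<close>.  The cluster \<open>k\<close> is
  fixed, so the index \<open>k\<close> is dropped throughout.\<close>

record ('u, 's) cluster =
  sectors :: "'s set"
  users :: "'u set"
  assoc :: "'u \<Rightarrow> 's \<Rightarrow> real"
  sinr :: "'u \<Rightarrow> 's \<Rightarrow> real"
  joint_sinr :: "'u \<Rightarrow> real"
  rate_const :: real
  spec_eff :: "real \<Rightarrow> real"

definition rate :: "('u, 's) cluster \<Rightarrow> 'u \<Rightarrow> 's \<Rightarrow> real" where
  "rate C u s = rate_const C * spec_eff C (sinr C u s)"

definition joint_rate :: "('u, 's) cluster \<Rightarrow> 'u \<Rightarrow> real" where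
  "joint_rate C u = rate_const C * spec_eff C (joint_sinr C u)"

definition comp_ind :: "('u, 's) cluster \<Rightarrow> real \<Rightarrow> 'u \<Rightarrow> 's \<Rightarrow> real" where
  "comp_ind C \<Gamma> u s =
     (if card (sectors C) > 1 \<and> sinr C u s \<le> \<Gamma> * assoc C u s then 1 else 0)"

definition comp_users :: "('u, 's) cluster \<Rightarrow> real \<Rightarrow> 'u set" where
  "comp_users C \<Gamma> =
     {u \<in> users C. \<exists>s\<in>sectors C. assoc C u s = 1 \<and> comp_ind C \<Gamma> u s = 1}"

definition noncomp_users :: "('u, 's) cluster \<Rightarrow> real \<Rightarrow> 's \<Rightarrow> 'u set" where
  "noncomp_users C \<Gamma> s = {u \<in> users C. assoc C u s = 1 \<and> comp_ind C \<Gamma> u s = 0}"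

text \<open>An allocation is a pair \<open>(b, d)\<close> with \<open>b u s\<close> the fraction \<open>\<beta>\<^sub>u\<^sub>,\<^sub>s\<close> of
  \<open>1 - \<theta>\<close> and \<open>d u\<close> the fraction \<open>\<beta>\<^sub>u\<^sub>,\<^sub>k\<close> of \<open>\<theta>\<close>.\<close>

type_synonym ('u, 's) alloc = "('u \<Rightarrow> 's \<Rightarrow> real) \<times> ('u \<Rightarrow> real)"

definition user_rate ::
  "('u, 's) cluster \<Rightarrow> real \<Rightarrow> real \<Rightarrow> ('u, 's) alloc \<Rightarrow> 'u \<Rightarrow> real" where
  "user_rate C \<Gamma> \<theta> a u =
     (1 - \<theta>) * (\<Sum>s\<in>sectors C. assoc C u s * (1 - comp_ind C \<Gamma> u s) * fst a u s * rate C u s)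
     + \<theta> * (\<Sum>s\<in>sectors C. assoc C u s * comp_ind C \<Gamma> u s * snd a u * joint_rate C u)"

text \<open>Values are extended reals because a user of rate 0 has utility \<open>-\<infinity>\<close> when
  \<open>\<alpha> \<ge> 1\<close>; the real-valued \<open>ln 0\<close> and \<open>0 powr (1 - \<alpha>)\<close> would both be 0.\<close>

definition utility :: "real \<Rightarrow> real \<Rightarrow> ereal" where
  "utility \<alpha> l =
     (if l = 0 \<and> \<alpha> \<ge> 1 then - \<infinity>
      else if \<alpha> = 1 then ereal (ln l)
      else ereal (l powr (1 - \<alpha>) / (1 - \<alpha>)))"

definition total_utility ::
  "('u, 's) cluster \<Rightarrow> real \<Rightarrow> real \<Rightarrow> real \<Rightarrow> ('u, 's) alloc \<Rightarrow> ereal" where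
  "total_utility C \<Gamma> \<alpha> \<theta> a = (\<Sum>u\<in>users C. utility \<alpha> (user_rate C \<Gamma> \<theta> a u))"

definition feasible :: "('u, 's) cluster \<Rightarrow> real \<Rightarrow> ('u, 's) alloc \<Rightarrow> bool" where
  "feasible C \<Gamma> a \<longleftrightarrow>
     (\<forall>s\<in>sectors C. (\<Sum>u\<in>noncomp_users C \<Gamma> s. fst a u s) \<le> 1) \<and>
     (\<Sum>u\<in>comp_users C \<Gamma>. snd a u) \<le> 1 \<and>
     (\<forall>u\<in>users C. \<forall>s\<in>sectors C. fst a u s \<ge> 0) \<and>
     (\<forall>u\<in>users C. snd a u \<ge> 0)"

definition optimal ::
  "('u, 's) cluster \<Rightarrow> real \<Rightarrow> real \<Rightarrow> real \<Rightarrow> ('u, 's) alloc \<Rightarrow> bool" where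
  "optimal C \<Gamma> \<alpha> \<theta> = is_arg_max (total_utility C \<Gamma> \<alpha> \<theta>) (feasible C \<Gamma>)"

text \<open>A user of rate 0 gets weight 0, also for \<open>\<alpha> \<ge> 1\<close>, where the power is
  infinite or \<open>0\<^sup>0\<close>.  For such \<open>\<alpha>\<close>, if this is the rate at which the user is
  served, the total utility is \<open>-\<infinity>\<close> for every feasible allocation.\<close>

definition weight :: "('u, 's) cluster \<Rightarrow> real \<Rightarrow> 'u \<Rightarrow> 's \<Rightarrow> real" where
  "weight C \<alpha> u s = rate C u s powr ((1 - \<alpha>) / \<alpha>)"

definition joint_weight :: "('u, 's) cluster \<Rightarrow> real \<Rightarrow> 'u \<Rightarrow> real" where
  "joint_weight C \<alpha> u = joint_rate C u powr ((1 - \<alpha>) / \<alpha>)"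

text \<open>Both formulas are used for all \<open>u\<close> and \<open>s\<close>; the rates \<open>user_rate\<close> and the
  upper bounds in \<open>feasible\<close> only see \<open>noncomp_frac u s\<close> with \<open>u \<in> noncomp_users C \<Gamma> s\<close> and
  \<open>joint_frac u\<close> with \<open>u \<in> comp_users C \<Gamma>\<close>.\<close>

definition noncomp_frac :: "('u, 's) cluster \<Rightarrow> real \<Rightarrow> real \<Rightarrow> 'u \<Rightarrow> 's \<Rightarrow> real" where
  "noncomp_frac C \<Gamma> \<alpha> u s = weight C \<alpha> u s / (\<Sum>v\<in>noncomp_users C \<Gamma> s. weight C \<alpha> v s)"

definition joint_frac :: "('u, 's) cluster \<Rightarrow> real \<Rightarrow> real \<Rightarrow> 'u \<Rightarrow> real" where
  "joint_frac C \<Gamma> \<alpha> u = joint_weight C \<alpha> u / (\<Sum>v\<in>comp_users C \<Gamma>. joint_weight C \<alpha> v)"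

end

theory Submission imports Defs begin

text \<open>Each user is served from exactly one time budget: \<open>\<theta>\<close>, shared by the CoMP users, or the
  \<open>1 - \<theta>\<close> of its own sector.  So the problem splits into budgets: maximize
  \<open>\<Sum>u. U (c * r u * x u)\<close> subject to \<open>\<Sum>u. x u \<le> 1\<close>.  At the claimed allocation
  the marginal utility \<open>U' (c * r u * x u) * c * r u\<close> has the same value
  \<open>c powr (1 - \<alpha>) * W powr \<alpha>\<close> for all users of positive rate, \<open>W\<close> being the sum of the
  weights.  Hence the tangent-line bounds of the strictly concave \<open>U\<close> add up to optimality, and
  equality forces equality user by user.\<close>

section \<open>The utility function\<close>

lemma utility_not_PInf [simp]: "utility \<alpha> l \<noteq> \<infinity>"
  by (simp add: utility_def)

lemma utility_eq_MInf_iff: "utility \<alpha> l = - \<infinity> \<longleftrightarrow> l = 0 \<and> \<alpha> \<ge> 1"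
  by (simp add: utility_def)

lemma ereal_real_utility: "utility \<alpha> l \<noteq> - \<infinity> \<Longrightarrow> ereal (real_of_ereal (utility \<alpha> l)) = utility \<alpha> l"
  by (auto simp: utility_def)

text \<open>The derivative \<open>y powr (- \<alpha>)\<close> is strictly decreasing, so the mean
  value theorem between \<open>l\<close> and \<open>m\<close> compares the secant slope strictly
  with the tangent slope at \<open>m\<close>.\<close>

lemma utility_real_strict_concave:
  fixes \<alpha> l m :: real
  defines "F \<equiv> \<lambda>y::real. if \<alpha> = 1 then ln y else y powr (1 - \<alpha>) / (1 - \<alpha>)"
  assumes "\<alpha> > 0" "l > 0" "m > 0" "l \<noteq> m"
  shows "F l < F m + m powr (- \<alpha>) * (l - m)"
proof -
  have der: "(F has_real_derivative y powr (- \<alpha>)) (at y)" if "y > 0" for y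
  proof (cases "\<alpha> = 1")
    case True
    then show ?thesis
      using that by (auto simp: F_def powr_minus field_simps intro!: derivative_eq_intros)
  next
    case False
    have "((\<lambda>y. y powr (1 - \<alpha>) / (1 - \<alpha>)) has_real_derivative y powr (- \<alpha>)) (at y)"
      using that False by (auto intro!: derivative_eq_intros)
    with False show ?thesis by (simp add: F_def)
  qed
  show ?thesis
  proof (cases "l < m")
    case True
    obtain z where z: "l < z" "z < m" "F m - F l = (m - l) * z powr (- \<alpha>)"
      using MVT2[OF True, of F "\<lambda>y. y powr (- \<alpha>)"] der \<open>l > 0\<close> by force
    have "m powr (- \<alpha>) < z powr (- \<alpha>)"
      using z assms by (intro powr_less_mono2_neg) auto
    then have "(m - l) * m powr (- \<alpha>) < (m - l) * z powr (- \<alpha>)"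
      using True by simp
    with z show ?thesis by (simp add: algebra_simps)
  next
    case False
    then have "m < l" using assms by simp
    then obtain z where z: "m < z" "z < l" "F l - F m = (l - m) * z powr (- \<alpha>)"
      using MVT2[of m l F "\<lambda>y. y powr (- \<alpha>)"] der \<open>m > 0\<close> by force
    have "z powr (- \<alpha>) < m powr (- \<alpha>)"
      using z assms by (intro powr_less_mono2_neg) auto
    then have "(l - m) * z powr (- \<alpha>) < (l - m) * m powr (- \<alpha>)"
      using \<open>m < l\<close> by simp
    with z show ?thesis by (simp add: algebra_simps)
  qed
qed

text \<open>Extends the tangent-line bound to rate 0, where for \<alpha> \<ge> 1 the left side is
  -\<infinity>.\<close>

lemma utility_strict_concave:
  assumes "\<alpha> > 0" "l \<ge> 0" "m > 0" "l \<noteq> m"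
  shows "utility \<alpha> l < utility \<alpha> m + ereal (m powr (- \<alpha>) * (l - m))"
proof (cases "l = 0")
  case False
  with assms utility_real_strict_concave[of \<alpha> l m] show ?thesis
    by (cases "\<alpha> = 1") (simp_all add: utility_def)
next
  case True
  show ?thesis
  proof (cases "\<alpha> \<ge> 1")
    case True
    with \<open>l = 0\<close> \<open>m > 0\<close> show ?thesis by (simp add: utility_def)
  next
    case False
    \<comment> \<open>For \<alpha> < 1 the left side of the goal is 0 and the right side is \<open>m
      powr (1 - \<alpha>) / (1 - \<alpha>) - m powr (1 - \<alpha>)\<close>, which is positive
      because 0 < 1 - \<alpha> < 1.\<close>
    have "m powr (- \<alpha>) * m = m powr (1 - \<alpha>)"
      using powr_mult_base[of m "- \<alpha>"] \<open>m > 0\<close> by (simp add: mult.commute)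
    moreover have "m powr (1 - \<alpha>) < m powr (1 - \<alpha>) / (1 - \<alpha>)"
      using False assms by (simp add: field_simps)
    ultimately show ?thesis
      using False \<open>l = 0\<close> \<open>m > 0\<close> by (simp add: utility_def)
  qed
qed

text \<open>The summands must avoid \<infinity> because in \<open>ereal\<close> it absorbs
  -\<infinity> under addition.\<close>

lemma sum_ereal_eq_MInf_iff:
  fixes f :: "'a \<Rightarrow> ereal"
  assumes "finite A" "\<And>i. i \<in> A \<Longrightarrow> f i \<noteq> \<infinity>"
  shows "sum f A = - \<infinity> \<longleftrightarrow> (\<exists>i\<in>A. f i = - \<infinity>)"
  using assms
proof (induction A rule: finite_induct)
  case (insert a A)
  then have "sum f A \<noteq> \<infinity>" by (simp add: sum_Pinfty)
  with insert show ?case by (auto simp: ereal_plus_eq_MInfty)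
qed simp

section \<open>Budgets shared by groups of users\<close>

text \<open>\<open>r\<close> times its weight is \<open>r powr (1 / \<alpha>)\<close>, whose power
  -\<alpha> is 1 / \<open>r\<close> and cancels the factor \<open>r\<close> of the chain rule. The
  exponent of the weights is chosen for this cancellation.\<close>

lemma marginal_utility:
  fixes \<alpha> c r W :: real
  assumes "\<alpha> > 0" "c > 0" "r > 0" "W > 0"
  shows "(c * r * (r powr ((1 - \<alpha>) / \<alpha>) / W)) powr (- \<alpha>) * (c * r) = c powr (1 - \<alpha>) * W powr \<alpha>"
proof -
  have "r * r powr ((1 - \<alpha>) / \<alpha>) = r powr (1 + (1 - \<alpha>) / \<alpha>)"
    using assms by (intro powr_mult_base) simp
  also have "1 + (1 - \<alpha>) / \<alpha> = 1 / \<alpha>"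
    using assms by (simp add: field_simps)
  finally have "c * r * (r powr ((1 - \<alpha>) / \<alpha>) / W) = c * r powr (1 / \<alpha>) / W"
    by simp
  moreover have "(c * r powr (1 / \<alpha>) / W) powr (- \<alpha>) = c powr (- \<alpha>) * inverse r * W powr \<alpha>"
    using assms by (simp add: powr_mult powr_divide powr_powr powr_minus_divide
        inverse_eq_divide mult.commute)
  moreover have "c powr (- \<alpha>) * c = c powr (1 - \<alpha>)"
    using powr_mult_base[of c "- \<alpha>"] assms by (simp add: mult.commute)
  ultimately show ?thesis
    using assms by (simp add: field_simps)
qed

text \<open>\<open>g u\<close> is the budget that serves \<open>u\<close>, \<open>c h\<close> the
  time that budget \<open>h\<close> has, and \<open>r u\<close> the link rate. Both may be 0, since
  \<theta> may be 0 or 1 and the spectral efficiency may vanish.\<close>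

locale budget_problem =
  fixes \<alpha> :: real and U :: "'u set" and g :: "'u \<Rightarrow> 'g" and c :: "'g \<Rightarrow> real" and r :: "'u \<Rightarrow> real"
  assumes \<alpha>_pos: "\<alpha> > 0" and finite_U: "finite U"
    and c_nonneg: "\<And>u. u \<in> U \<Longrightarrow> c (g u) \<ge> 0" and r_nonneg: "\<And>u. u \<in> U \<Longrightarrow> r u \<ge> 0"
begin

definition members :: "'g \<Rightarrow> 'u set" where
  "members h = {u \<in> U. g u = h}"

definition wt :: "'u \<Rightarrow> real" where
  "wt u = r u powr ((1 - \<alpha>) / \<alpha>)"

definition share :: "'u \<Rightarrow> real" where
  "share u = wt u / sum wt (members (g u))"

definition value_of :: "('u \<Rightarrow> real) \<Rightarrow> ereal" where
  "value_of x = (\<Sum>u\<in>U. utility \<alpha> (c (g u) * r u * x u))"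

definition admissible :: "('u \<Rightarrow> real) \<Rightarrow> bool" where
  "admissible x \<longleftrightarrow> (\<forall>u\<in>U. x u \<ge> 0) \<and> (\<forall>h\<in>g ` U. sum x (members h) \<le> 1)"

lemma value_eq_MInf_iff: "value_of x = - \<infinity> \<longleftrightarrow> (\<exists>u\<in>U. utility \<alpha> (c (g u) * r u * x u) = - \<infinity>)"
  unfolding value_of_def using finite_U by (intro sum_ereal_eq_MInf_iff) auto

section \<open>Multipliers and tangent-line bounds at the shares\<close>

text \<open>The Lagrange multiplier of budget \<open>h\<close>: the common marginal utility of its
  users of positive rate. It is 0 for a budget without time or without such a user, where the
  fractions affect no rate.\<close>

definition slope :: "'g \<Rightarrow> real" where
  "slope h = (if c h > 0 \<and> (\<exists>v\<in>members h. r v > 0)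
     then c h powr (1 - \<alpha>) * sum wt (members h) powr \<alpha> else 0)"

lemma slope_nonneg: "slope h \<ge> 0"
  by (simp add: slope_def)

lemma slope_eq_0: "sum wt (members h) = 0 \<Longrightarrow> slope h = 0"
  by (simp add: slope_def)

lemma sum_wt_pos: "u \<in> members h \<Longrightarrow> r u > 0 \<Longrightarrow> sum wt (members h) > 0"
  using finite_U by (intro sum_pos2[of _ u]) (auto simp: members_def wt_def)

lemma utility_less_tangent:
  assumes u: "u \<in> U" and budget: "c (g u) > 0" "\<exists>v\<in>members (g u). r v > 0"
    and t: "t \<ge> 0" "t \<noteq> share u"
    and fin: "utility \<alpha> (c (g u) * r u * share u) \<noteq> - \<infinity>"
  shows "utility \<alpha> (c (g u) * r u * t)
    < utility \<alpha> (c (g u) * r u * share u) + ereal (slope (g u) * (t - share u))"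
proof -
  define W where "W = sum wt (members (g u))"
  have "W > 0" using budget(2) sum_wt_pos by (auto simp: W_def)
  have slope: "slope (g u) = c (g u) powr (1 - \<alpha>) * W powr \<alpha>"
    using budget by (simp add: slope_def W_def)
  then have "slope (g u) > 0" using budget(1) \<open>W > 0\<close> by simp
  have share: "share u = wt u / W" by (simp add: share_def W_def)
  show ?thesis
  proof (cases "r u = 0")
    case True
    \<comment> \<open>Finiteness at the share excludes \<alpha> \<ge> 1. The utility is then 0 for
      every \<open>t\<close>, and strictness comes from \<open>t > 0\<close> and the positive
      slope.\<close>
    then have "share u = 0" "\<alpha> < 1" using fin by (auto simp: share wt_def utility_eq_MInf_iff)
    then show ?thesis using True t \<open>slope (g u) > 0\<close> by (simp add: utility_def)
  next
    case False
    then have "r u > 0" using r_nonneg[OF u] by simp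
    then have "share u > 0" using \<open>W > 0\<close> by (simp add: share wt_def)
    \<comment> \<open>By this identity the tangent in the rate becomes a tangent in the fraction,
      with the same slope for the whole budget.\<close>
    have "(c (g u) * r u * share u) powr (- \<alpha>) * (c (g u) * r u) = slope (g u)"
      using marginal_utility[of \<alpha> "c (g u)" "r u" W] budget(1) \<open>r u > 0\<close> \<open>W > 0\<close> \<alpha>_pos
      by (simp only: slope share wt_def)
    then have "(c (g u) * r u * share u) powr (- \<alpha>) * (c (g u) * r u * t - c (g u) * r u * share u)
        = slope (g u) * (t - share u)"
      by (metis mult.assoc right_diff_distrib)
    moreover have "utility \<alpha> (c (g u) * r u * t) < utility \<alpha> (c (g u) * r u * share u)
        + ereal ((c (g u) * r u * share u) powr (- \<alpha>) * (c (g u) * r u * t - c (g u) * r u * share u))"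
      using budget(1) \<open>r u > 0\<close> \<open>share u > 0\<close> t \<alpha>_pos by (intro utility_strict_concave) auto
    ultimately show ?thesis by simp
  qed
qed

text \<open>In a budget without time or positive rate, the utility is constant in \<open>t\<close>
  and the slope is 0. Elsewhere the strict bound applies, unless \<open>t\<close> is the share or
  the utility at the share is -\<infinity>.\<close>

lemma utility_le_tangent:
  assumes u: "u \<in> U" and t: "t \<ge> 0"
  shows "utility \<alpha> (c (g u) * r u * t)
    \<le> utility \<alpha> (c (g u) * r u * share u) + ereal (slope (g u) * (t - share u))"
proof (cases "c (g u) > 0 \<and> (\<exists>v\<in>members (g u). r v > 0)")
  case False
  then have "c (g u) = 0 \<or> r u = 0"
    using u c_nonneg[OF u] r_nonneg[OF u] by (auto simp: members_def order_le_less)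
  moreover have "slope (g u) = 0"
    using False by (auto simp: slope_def)
  ultimately show ?thesis by (auto simp flip: zero_ereal_def)
next
  case True
  then have "sum wt (members (g u)) > 0" using sum_wt_pos by auto
  consider "t = share u" | "utility \<alpha> (c (g u) * r u * share u) = - \<infinity>"
    | "t \<noteq> share u" "utility \<alpha> (c (g u) * r u * share u) \<noteq> - \<infinity>" by blast
  then show ?thesis
  proof cases
    case 1
    then show ?thesis by (simp flip: zero_ereal_def)
  next
    case 2
    \<comment> \<open>A positive link rate would give a positive share, so the rate vanishes at the
      share only if it vanishes for every \<open>t\<close>.\<close>
    then have "\<alpha> \<ge> 1" "c (g u) * r u = 0"
      using \<open>sum wt (members (g u)) > 0\<close> by (auto simp: utility_eq_MInf_iff share_def wt_def)
    then have "utility \<alpha> (c (g u) * r u * t) = - \<infinity>"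
      by (simp add: utility_eq_MInf_iff)
    then show ?thesis by simp
  next
    case 3
    then show ?thesis using utility_less_tangent u t True by (simp add: less_imp_le)
  qed
qed

section \<open>Optimality and uniqueness of the shares\<close>

lemma sum_share: "sum share (members h) = (if sum wt (members h) = 0 then 0 else 1)"
proof -
  have "sum share (members h) = (\<Sum>u\<in>members h. wt u / sum wt (members h))"
    by (intro sum.cong) (auto simp: share_def members_def)
  then show ?thesis by (simp flip: sum_divide_distrib)
qed

text \<open>The tangent-line bounds add up to a linear error term that is at most 0 budget by
  budget. If the values agree, no single bound can be strict.\<close>

lemma admissible_value:
  assumes adm: "admissible x" and fin: "value_of x \<noteq> - \<infinity>"
  shows "value_of x \<le> value_of share"
    and "value_of x = value_of share \<Longrightarrow> u \<in> U \<Longrightarrow> c (g u) > 0 \<Longrightarrow> \<exists>v\<in>members (g u). r v > 0 \<Longrightarrow>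
      x u = share u"
proof -
  have x_nonneg: "x u \<ge> 0" if "u \<in> U" for u
    using adm that by (simp add: admissible_def)
  let ?ut = "\<lambda>x u. utility \<alpha> (c (g u) * r u * x u)"
  have weak: "?ut x u \<le> ?ut share u + ereal (slope (g u) * (x u - share u))" if "u \<in> U" for u
    using utility_le_tangent x_nonneg that by blast
  have "(\<Sum>u\<in>U. slope (g u) * (x u - share u)) = 
      (\<Sum>h\<in>g ` U. \<Sum>u\<in>members h. slope (g u) * (x u - share u))"
    unfolding members_def by (rule sum.image_gen[OF finite_U])
  also have "\<dots> = (\<Sum>h\<in>g ` U. slope h * (sum x (members h) - sum share (members h)))"
    by (intro sum.cong refl) (simp add: members_def sum_distrib_left flip: sum_subtractf)
  also have "\<dots> \<le> 0"
  \<comment> \<open>The shares sum to 1 and \<open>x\<close> to at most 1; where all weights vanish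
    the shares sum to 0, but there the slope is 0.\<close>
  proof (intro sum_nonpos)
    fix h assume "h \<in> g ` U"
    then show "slope h * (sum x (members h) - sum share (members h)) \<le> 0"
      using slope_nonneg slope_eq_0 adm by (auto simp: sum_share admissible_def mult_nonneg_nonpos)
  qed
  finally have slack: "(\<Sum>u\<in>U. slope (g u) * (x u - share u)) \<le> 0" .

  have finx: "?ut x u \<noteq> - \<infinity>" if "u \<in> U" for u
    using fin that by (simp add: value_eq_MInf_iff)
  \<comment> \<open>The bounds carry finiteness from \<open>x\<close> to the shares, so from here on
    the sums are real and a strict inequality in one summand survives summation.\<close>
  have fins: "?ut share u \<noteq> - \<infinity>" if "u \<in> U" for u
    using weak[OF that] finx[OF that] by auto
  define p q where "p u = real_of_ereal (?ut x u)" and "q u = real_of_ereal (?ut share u)" for u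
  have p: "?ut x u = ereal (p u)" and q: "?ut share u = ereal (q u)" if "u \<in> U" for u
    using finx[OF that] fins[OF that] by (simp_all add: p_def q_def ereal_real_utility)
  have V: "value_of x = ereal (sum p U)" "value_of share = ereal (sum q U)"
    by (simp_all add: value_of_def p q)
  have le: "p u \<le> q u + slope (g u) * (x u - share u)" if "u \<in> U" for u
    using weak[OF that] that by (simp add: p q)
  have "sum p U \<le> (\<Sum>u\<in>U. q u + slope (g u) * (x u - share u))"
    using le by (intro sum_mono)
  with slack show "value_of x \<le> value_of share"
    by (simp add: V sum.distrib)
  assume eq: "value_of x = value_of share" and u: "u \<in> U" "c (g u) > 0" "\<exists>v\<in>members (g u). r v > 0"
  show "x u = share u"
  proof (rule ccontr)
    assume "x u \<noteq> share u"
    then have "p u < q u + slope (g u) * (x u - share u)"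
      using utility_less_tangent[OF u, of "x u"] x_nonneg[OF u(1)] fins[OF u(1)] u(1) by (simp add: p q)
    then have "sum p U < (\<Sum>u\<in>U. q u + slope (g u) * (x u - share u))"
      using le u(1) finite_U by (intro sum_strict_mono_ex1) auto
    with slack eq show False by (simp add: V sum.distrib)
  qed
qed

lemma value_share_max: "admissible x \<Longrightarrow> value_of x \<le> value_of share"
  using admissible_value(1)[of x] by (cases "value_of x = - \<infinity>") auto

text \<open>Positive link rates give positive shares, so no user is left with rate 0.\<close>

lemma value_share_finite:
  assumes "\<And>u. u \<in> U \<Longrightarrow> c (g u) > 0" "\<And>u. u \<in> U \<Longrightarrow> r u > 0"
  shows "value_of share \<noteq> - \<infinity>"
proof -
  have "share u > 0" if "u \<in> U" for u
  proof -
    have "sum wt (members (g u)) > 0"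
      using that assms(2) by (intro sum_wt_pos[of u]) (auto simp: members_def)
    moreover have "wt u > 0" using assms(2)[OF that] by (simp add: wt_def)
    ultimately show ?thesis by (simp add: share_def)
  qed
  then show ?thesis
    using assms by (force simp: value_eq_MInf_iff utility_eq_MInf_iff)
qed

end

section \<open>The cluster\<close>

locale comp_cluster =
  fixes C :: "('u, 's) cluster" and \<alpha> \<Gamma> \<theta> :: real
  assumes pos: "\<alpha> > 0"
    and fin_sectors: "finite (sectors C)" and fin_users: "finite (users C)"
    and assoc01: "\<And>u s. u \<in> users C \<Longrightarrow> s \<in> sectors C \<Longrightarrow> assoc C u s \<in> {0, 1}"
    and assoc_unique: "\<And>u. u \<in> users C \<Longrightarrow> \<exists>!s. s \<in> sectors C \<and> assoc C u s = 1"
    and rate_const: "rate_const C > 0"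
    and spec_eff: "\<And>g. spec_eff C g \<ge> 0"
    and \<theta>: "0 \<le> \<theta>" "\<theta> \<le> 1"
begin

definition home :: "'u \<Rightarrow> 's" where
  "home u = (THE s. s \<in> sectors C \<and> assoc C u s = 1)"

lemma home: "u \<in> users C \<Longrightarrow> home u \<in> sectors C" "u \<in> users C \<Longrightarrow> assoc C u (home u) = 1"
  unfolding home_def using theI'[OF assoc_unique, of u] by auto

lemma home_eq: "u \<in> users C \<Longrightarrow> s \<in> sectors C \<Longrightarrow> assoc C u s = 1 \<longleftrightarrow> s = home u"
  using assoc_unique[of u] home[of u] by auto

lemma comp_ind_cases: "comp_ind C \<Gamma> u s = 0 \<or> comp_ind C \<Gamma> u s = 1"
  by (simp add: comp_ind_def)

text \<open>\<open>None\<close> is the joint budget of the CoMP users, \<open>Some s\<close> the budget of sector \<open>s\<close>.\<close>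

definition budget :: "'u \<Rightarrow> 's option" where
  "budget u = (if comp_ind C \<Gamma> u (home u) = 1 then None else Some (home u))"

definition budget_time :: "'s option \<Rightarrow> real" where
  "budget_time h = (if h = None then \<theta> else 1 - \<theta>)"

definition link_rate :: "'u \<Rightarrow> real" where
  "link_rate u = (case budget u of None \<Rightarrow> joint_rate C u | Some s \<Rightarrow> rate C u s)"

text \<open>The single entry of the allocation that can influence the rate of
  \<open>u\<close>.\<close>

definition fraction :: "('u, 's) alloc \<Rightarrow> 'u \<Rightarrow> real" where
  "fraction a u = (case budget u of None \<Rightarrow> snd a u | Some s \<Rightarrow> fst a u s)"

lemma budget_time_nonneg: "budget_time h \<ge> 0"
  using \<theta> by (simp add: budget_time_def)

lemma link_rate_nonneg: "link_rate u \<ge> 0"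
  using rate_const spec_eff
  by (simp add: link_rate_def rate_def joint_rate_def split: option.split)

sublocale budget_problem \<alpha> "users C" budget budget_time link_rate
  by unfold_locales (rule pos fin_users budget_time_nonneg link_rate_nonneg)+

section \<open>Translation of the cluster into budgets\<close>

lemma comp_users_eq: "comp_users C \<Gamma> = members None"
proof -
  have "(\<exists>s\<in>sectors C. assoc C u s = 1 \<and> comp_ind C \<Gamma> u s = 1) \<longleftrightarrow> budget u = None"
    if "u \<in> users C" for u
    using home[OF that] home_eq[OF that] by (auto simp: budget_def)
  then show ?thesis by (auto simp: comp_users_def members_def)
qed

lemma noncomp_users_eq:
  assumes "s \<in> sectors C"
  shows "noncomp_users C \<Gamma> s = members (Some s)"
proof -
  have "assoc C u s = 1 \<and> comp_ind C \<Gamma> u s = 0 \<longleftrightarrow> budget u = Some s" if "u \<in> users C" for u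
    using home_eq[OF that assms] comp_ind_cases[of u s] by (auto simp: budget_def)
  then show ?thesis by (auto simp: noncomp_users_def members_def)
qed

lemma members_budget:
  "u \<in> members None \<Longrightarrow> budget u = None" "u \<in> members (Some s) \<Longrightarrow> budget u = Some s"
  by (simp_all add: members_def)

text \<open>Only the home sector has a nonzero association, and the CoMP indicator there, being 0 or
  1, removes one of the two terms of the rate.\<close>

lemma user_rate_eq:
  assumes "u \<in> users C"
  shows "user_rate C \<Gamma> \<theta> a u = budget_time (budget u) * link_rate u * fraction a u"
proof -
  have "(\<Sum>s\<in>sectors C. assoc C u s * f s) = f (home u)" for f :: "'s \<Rightarrow> real"
  proof -
    have "(\<Sum>s\<in>sectors C. assoc C u s * f s) = (\<Sum>s\<in>sectors C. if s = home u then f s else 0)"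
      using assoc01[OF assms] home_eq[OF assms] by (intro sum.cong) fastforce+
    then show ?thesis using fin_sectors home(1)[OF assms] by simp
  qed
  then show ?thesis
    using comp_ind_cases[of u "home u"]
    by (auto simp: user_rate_def budget_def budget_time_def link_rate_def fraction_def mult.assoc)
qed

lemma total_utility_eq: "total_utility C \<Gamma> \<alpha> \<theta> a = value_of (fraction a)"
  by (simp add: total_utility_def value_of_def user_rate_eq)

lemma sum_fraction:
  "sum (fraction a) (members None) = (\<Sum>u\<in>members None. snd a u)"
  "sum (fraction a) (members (Some s)) = (\<Sum>u\<in>members (Some s). fst a u s)"
  by (auto intro!: sum.cong simp: fraction_def members_budget)

text \<open>This direction suffices: it bounds all feasible allocations, and feasibility of
  \<open>fair\<close> is checked separately.\<close>

lemma feasible_admissible: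
  assumes "feasible C \<Gamma> a"
  shows "admissible (fraction a)"
  unfolding admissible_def
proof (intro conjI ballI)
  fix u assume "u \<in> users C"
  then show "fraction a u \<ge> 0"
    using assms home(1) by (auto simp: feasible_def fraction_def budget_def)
next
  fix h assume "h \<in> budget ` users C"
  then have "h = None \<or> (\<exists>s\<in>sectors C. h = Some s)"
    using home(1) by (auto simp: budget_def)
  then show "sum (fraction a) (members h) \<le> 1"
    using assms by (auto simp: feasible_def sum_fraction comp_users_eq noncomp_users_eq)
qed

abbreviation "fair \<equiv> (noncomp_frac C \<Gamma> \<alpha>, joint_frac C \<Gamma> \<alpha>)"

lemma sum_wt:
  "sum wt (members None) = sum (joint_weight C \<alpha>) (members None)"
  "sum wt (members (Some s)) = (\<Sum>u\<in>members (Some s). weight C \<alpha> u s)"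
  by (auto intro!: sum.cong simp: wt_def joint_weight_def weight_def link_rate_def members_budget)

lemma joint_frac_eq: "u \<in> members None \<Longrightarrow> joint_frac C \<Gamma> \<alpha> u = share u"
  by (simp add: joint_frac_def share_def members_budget comp_users_eq sum_wt)
    (simp add: wt_def joint_weight_def link_rate_def members_budget)

lemma noncomp_frac_eq:
  "s \<in> sectors C \<Longrightarrow> u \<in> members (Some s) \<Longrightarrow> noncomp_frac C \<Gamma> \<alpha> u s = share u"
  by (simp add: noncomp_frac_def share_def members_budget noncomp_users_eq sum_wt)
    (simp add: wt_def weight_def link_rate_def members_budget)

lemma fraction_fair: "u \<in> users C \<Longrightarrow> fraction fair u = share u"
  using joint_frac_eq[of u] noncomp_frac_eq[of "home u" u] home(1)[of u]
  by (auto simp: fraction_def budget_def members_def)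

lemma total_utility_fair: "total_utility C \<Gamma> \<alpha> \<theta> fair = value_of share"
  by (simp add: total_utility_eq value_of_def fraction_fair)

lemma feasible_fair: "feasible C \<Gamma> fair"
proof -
  \<comment> \<open>Nonnegativity is required for every user and sector, also for pairs that no
    budget serves, so it is read off the formulas and not off \<open>share\<close>.\<close>
  have "noncomp_frac C \<Gamma> \<alpha> u s \<ge> 0" "joint_frac C \<Gamma> \<alpha> u \<ge> 0" for u s
    by (auto simp: noncomp_frac_def joint_frac_def weight_def joint_weight_def
        intro!: divide_nonneg_nonneg sum_nonneg)
  then show ?thesis
    by (auto simp: feasible_def comp_users_eq noncomp_users_eq joint_frac_eq noncomp_frac_eq sum_share)
qed

section \<open>Optimal allocations of the cluster\<close>

lemma optimal_fair: "optimal C \<Gamma> \<alpha> \<theta> fair"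
  unfolding optimal_def is_arg_max_def total_utility_fair
  using feasible_fair value_share_max feasible_admissible
  by (auto simp: total_utility_eq not_less)

text \<open>Every optimum has the value of the shares, so the equality case of
  \<open>admissible_value\<close> applies to each budget with time and a positive rate.\<close>

lemma optimal_fraction:
  assumes "optimal C \<Gamma> \<alpha> \<theta> a" "total_utility C \<Gamma> \<alpha> \<theta> a \<noteq> - \<infinity>"
    and "u \<in> members h" "budget_time h > 0" "\<exists>v\<in>members h. link_rate v > 0"
  shows "fraction a u = share u"
proof -
  have feas: "feasible C \<Gamma> a" and max: "\<not> total_utility C \<Gamma> \<alpha> \<theta> fair > total_utility C \<Gamma> \<alpha> \<theta> a"
    using assms(1) feasible_fair by (auto simp: optimal_def is_arg_max_def)
  have adm: "admissible (fraction a)" using feas by (rule feasible_admissible)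
  have "value_of (fraction a) = value_of share"
    using max value_share_max[OF adm]
    unfolding total_utility_fair unfolding total_utility_eq by simp
  then show ?thesis
    using admissible_value(2)[OF adm, of u] assms by (simp add: total_utility_eq members_def)
qed

lemma optimal_noncomp:
  assumes "optimal C \<Gamma> \<alpha> \<theta> (b, d)" "total_utility C \<Gamma> \<alpha> \<theta> (b, d) \<noteq> - \<infinity>" "\<theta> < 1"
    and s: "s \<in> sectors C" and "\<exists>v\<in>noncomp_users C \<Gamma> s. rate C v s > 0" "u \<in> noncomp_users C \<Gamma> s"
  shows "b u s = noncomp_frac C \<Gamma> \<alpha> u s"
proof -
  have u: "u \<in> members (Some s)" using assms by (simp add: noncomp_users_eq)
  have "\<exists>v\<in>members (Some s). link_rate v > 0"
    using assms(5) by (auto simp: noncomp_users_eq[OF s] link_rate_def members_budget)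
  then have "fraction (b, d) u = share u"
    using assms u by (intro optimal_fraction) (auto simp: budget_time_def)
  then show ?thesis using u s by (simp add: noncomp_frac_eq fraction_def members_budget)
qed

lemma optimal_comp:
  assumes "optimal C \<Gamma> \<alpha> \<theta> (b, d)" "total_utility C \<Gamma> \<alpha> \<theta> (b, d) \<noteq> - \<infinity>" "\<theta> > 0"
    and "\<exists>v\<in>comp_users C \<Gamma>. joint_rate C v > 0" "u \<in> comp_users C \<Gamma>"
  shows "d u = joint_frac C \<Gamma> \<alpha> u"
proof -
  have u: "u \<in> members None" using assms by (simp add: comp_users_eq)
  have "\<exists>v\<in>members None. link_rate v > 0"
    using assms(4) by (auto simp: comp_users_eq link_rate_def members_budget)
  then have "fraction (b, d) u = share u"
    using assms u by (intro optimal_fraction) (auto simp: budget_time_def)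
  then show ?thesis using u by (simp add: joint_frac_eq fraction_def members_budget)
qed

text \<open>Together with \<open>optimal_fair\<close> this makes every optimum finite, so the
  uniqueness claim has content.\<close>

lemma total_utility_fair_finite:
  assumes "0 < \<theta>" "\<theta> < 1"
    and nc: "\<forall>s\<in>sectors C. \<forall>u\<in>noncomp_users C \<Gamma> s. rate C u s > 0"
    and jt: "\<forall>u\<in>comp_users C \<Gamma>. joint_rate C u > 0"
  shows "total_utility C \<Gamma> \<alpha> \<theta> fair \<noteq> - \<infinity>"
proof -
  have "link_rate u > 0" if "u \<in> users C" for u
  proof (cases "budget u")
    case None
    then show ?thesis using jt that by (simp add: comp_users_eq members_def link_rate_def)
  next
    case (Some s)
    then have s: "s \<in> sectors C" using home(1)[OF that] by (auto simp: budget_def split: if_splits)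
    with nc have "\<forall>u\<in>members (Some s). rate C u s > 0" by (simp add: noncomp_users_eq)
    with Some that show ?thesis by (simp add: members_def link_rate_def)
  qed
  then show ?thesis
    unfolding total_utility_fair using assms by (intro value_share_finite) (auto simp: budget_time_def)
qed

end

text \<open>Uniqueness is claimed where it can hold: if the optimal value is -\<infinity>, every
  feasible allocation is optimal, and fractions of a budget without time or positive rates change no
  user's rate.\<close>

theorem proposition1:
  fixes C :: "('u, 's) cluster" and \<alpha> \<Gamma> \<theta> :: real
  assumes "\<alpha> > 0"
    and "finite (sectors C)" and "finite (users C)"
    and "\<And>u s. u \<in> users C \<Longrightarrow> s \<in> sectors C \<Longrightarrow> assoc C u s \<in> {0, 1}"
    and "\<And>u. u \<in> users C \<Longrightarrow> \<exists>!s. s \<in> sectors C \<and> assoc C u s = 1"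
    and "rate_const C > 0"
    and "\<And>g. spec_eff C g \<ge> 0"
    and "comp_users C \<Gamma> \<noteq> {}"
    and "0 \<le> \<theta>" and "\<theta> \<le> 1"
  shows "optimal C \<Gamma> \<alpha> \<theta> (noncomp_frac C \<Gamma> \<alpha>, joint_frac C \<Gamma> \<alpha>) \<and>
    (\<forall>b d. optimal C \<Gamma> \<alpha> \<theta> (b, d) \<longrightarrow> total_utility C \<Gamma> \<alpha> \<theta> (b, d) \<noteq> - \<infinity> \<longrightarrow>
      (\<theta> < 1 \<longrightarrow> (\<forall>s\<in>sectors C. (\<exists>v\<in>noncomp_users C \<Gamma> s. rate C v s > 0) \<longrightarrow>
         (\<forall>u\<in>noncomp_users C \<Gamma> s. b u s = noncomp_frac C \<Gamma> \<alpha> u s))) \<and>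
      (\<theta> > 0 \<longrightarrow> (\<exists>v\<in>comp_users C \<Gamma>. joint_rate C v > 0) \<longrightarrow>
         (\<forall>u\<in>comp_users C \<Gamma>. d u = joint_frac C \<Gamma> \<alpha> u))) \<and>
    (0 < \<theta> \<longrightarrow> \<theta> < 1 \<longrightarrow>
      (\<forall>s\<in>sectors C. \<forall>u\<in>noncomp_users C \<Gamma> s. rate C u s > 0) \<longrightarrow>
      (\<forall>u\<in>comp_users C \<Gamma>. joint_rate C u > 0) \<longrightarrow>
      total_utility C \<Gamma> \<alpha> \<theta> (noncomp_frac C \<Gamma> \<alpha>, joint_frac C \<Gamma> \<alpha>) \<noteq> - \<infinity>)"
proof -
  interpret comp_cluster C \<alpha> \<Gamma> \<theta>
    by unfold_locales (fact assms)+
  show ?thesis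
    by (intro conjI allI impI ballI)
      (rule optimal_fair optimal_noncomp optimal_comp total_utility_fair_finite; assumption)+
qed

end
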